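(* Let $a,b$ be positive semidefinite symmetric sesquilinear forms on a Hilbert space with the common dense domain $\mathcal{D}$ and respective lower bounds $\alpha,\beta\ge 0$, and such that $a + b$ is closed. Define the form $h$ on $\mathcal{D}\oplus\mathcal{D}$ by $h(x,y) = a(x_1,y_1) + b(x_2,y_1) + b(x_1,y_2) - a(x_2,y_2)$ for $x = (x_1,x_2)$, $y=(y_1,y_2)$ in $\mathcal{D}\oplus\mathcal{D}$. Then $h$ defines a unique selfadjoint operator $H$ with $\mathcal{D}(H) \subseteq \mathcal{D} \oplus \mathcal{D}$ and $h(x,y) = (Hx,y)$ for $x \in \mathcal{D}(H)$, $y \in \mathcal{D}\oplus \mathcal{D}$. Moreover, if any of $\alpha,\beta$ is non-zero then $H$ has a bounded inverse with $\|H^{-1}\| \leq \frac{1}{\sqrt{\alpha^2 + \beta^2}}$.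
   Context: The form $h$ is the form analogue of the block operator matrix $\begin{bmatrix} A & B \\ B & -A\end{bmatrix}$. Lower bound $\alpha$ of $a$ means $a(z,z)\ge \alpha\|z\|^2$ for all $z\in\mathcal{D}$ (similarly $\beta$ for $b$). In the bounded case with $A=a$, $B=b$ positive definite this reduces to the spectral gap $(-\sqrt{\min\sigma(A)^2+\min\sigma(B)^2},\sqrt{\min\sigma(A)^2+\min\sigma(B)^2})$ around zero. *)

theory Defs
  imports "HOL-Analysis.Analysis"
begin

text \<open>A complex Hilbert space is modelled as a real Hilbert space (type class
real_inner + complete_space) together with a complex structure J (multiplication
by the imaginary unit): J is real-linear, J (J x) = -x and J is orthogonal.\<close>

definition complex_structure :: "('a::real_inner \<Rightarrow> 'a) \<Rightarrow> bool" where
  "complex_structure J \<longleftrightarrow> linear J \<and> (\<forall>x. J (J x) = - x) \<and> (\<forall>x y. inner (J x) (J y) = inner x y)"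

definition cscale :: "('a::real_vector \<Rightarrow> 'a) \<Rightarrow> complex \<Rightarrow> 'a \<Rightarrow> 'a" where
  "cscale J c x = Re c *\<^sub>R x + Im c *\<^sub>R J x"

text \<open>The complex inner product, linear in the first and conjugate-linear in the
second argument; its real part is the real inner product.\<close>
definition cinner :: "('a::real_inner \<Rightarrow> 'a) \<Rightarrow> 'a \<Rightarrow> 'a \<Rightarrow> complex" where
  "cinner J x y = Complex (inner x y) (inner x (J y))"

text \<open>Complex structure on the direct sum H \<oplus> H (modelled by the product type,
whose inner product and norm are those of the Hilbert direct sum).\<close>
definition pairJ :: "('a \<Rightarrow> 'a) \<Rightarrow> 'a \<times> 'a \<Rightarrow> 'a \<times> 'a" where
  "pairJ J = map_prod J J"

definition csubspace :: "('a::real_vector \<Rightarrow> 'a) \<Rightarrow> 'a set \<Rightarrow> bool" where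
  "csubspace J D \<longleftrightarrow> subspace D \<and> (\<forall>x\<in>D. J x \<in> D)"

definition sesq_form :: "('a::real_vector \<Rightarrow> 'a) \<Rightarrow> 'a set \<Rightarrow> ('a \<Rightarrow> 'a \<Rightarrow> complex) \<Rightarrow> bool" where
  "sesq_form J D f \<longleftrightarrow>
     (\<forall>x\<in>D. \<forall>y\<in>D. \<forall>z\<in>D. f (x + y) z = f x z + f y z \<and> f z (x + y) = f z x + f z y) \<and>
     (\<forall>c. \<forall>x\<in>D. \<forall>y\<in>D. f (cscale J c x) y = c * f x y \<and> f x (cscale J c y) = cnj c * f x y)"

definition symmetric_form :: "'a set \<Rightarrow> ('a \<Rightarrow> 'a \<Rightarrow> complex) \<Rightarrow> bool" where
  "symmetric_form D f \<longleftrightarrow> (\<forall>x\<in>D. \<forall>y\<in>D. f x y = cnj (f y x))"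

definition closed_form :: "'a::real_normed_vector set \<Rightarrow> ('a \<Rightarrow> 'a \<Rightarrow> complex) \<Rightarrow> bool" where
  "closed_form D t \<longleftrightarrow>
     (\<forall>u x. (\<forall>n. u n \<in> D) \<longrightarrow> u \<longlonglongrightarrow> x \<longrightarrow>
        (\<forall>e>0. \<exists>N. \<forall>m\<ge>N. \<forall>n\<ge>N. cmod (t (u n - u m) (u n - u m)) < e) \<longrightarrow>
        x \<in> D \<and> ((\<lambda>n. cmod (t (u n - x) (u n - x))) \<longlonglongrightarrow> 0))"

text \<open>(Possibly unbounded) operators are partial maps; the domain is dom T.\<close>
definition adjoint_op :: "('a::real_inner \<Rightarrow> 'a) \<Rightarrow> ('a \<Rightarrow> 'a option) \<Rightarrow> 'a \<Rightarrow> 'a option" where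
  "adjoint_op J T y =
     (if \<exists>z. \<forall>x\<in>dom T. cinner J (the (T x)) y = cinner J x z
      then Some (THE z. \<forall>x\<in>dom T. cinner J (the (T x)) y = cinner J x z) else None)"

definition linear_op :: "('a::real_vector \<Rightarrow> 'a) \<Rightarrow> ('a \<Rightarrow> 'a option) \<Rightarrow> bool" where
  "linear_op J T \<longleftrightarrow> csubspace J (dom T) \<and>
     (\<forall>x\<in>dom T. \<forall>y\<in>dom T. the (T (x + y)) = the (T x) + the (T y)) \<and>
     (\<forall>c. \<forall>x\<in>dom T. the (T (cscale J c x)) = cscale J c (the (T x)))"

definition selfadjoint :: "('a::real_inner \<Rightarrow> 'a) \<Rightarrow> ('a \<Rightarrow> 'a option) \<Rightarrow> bool" where
  "selfadjoint J T \<longleftrightarrow> linear_op J T \<and> closure (dom T) = UNIV \<and> adjoint_op J T = T"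

definition bounded_inverse_le :: "('a::real_normed_vector \<Rightarrow> 'a option) \<Rightarrow> real \<Rightarrow> bool" where
  "bounded_inverse_le T c \<longleftrightarrow> (\<exists>G. bounded_linear G \<and> (\<forall>z. T (G z) = Some z) \<and>
       (\<forall>x\<in>dom T. G (the (T x)) = x) \<and> (\<forall>z. norm (G z) \<le> c * norm z))"

definition hform :: "('a \<Rightarrow> 'a \<Rightarrow> complex) \<Rightarrow> ('a \<Rightarrow> 'a \<Rightarrow> complex) \<Rightarrow> 'a \<times> 'a \<Rightarrow> 'a \<times> 'a \<Rightarrow> complex" where
  "hform a b x y = a (fst x) (fst y) + b (snd x) (fst y) + b (fst x) (snd y) - a (snd x) (snd y)"

end

theory Submission
  imports Defs
begin

text \<open>With \<open>U = [[1, 1], [1, -1]]\<close> one has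
  \<open>Re h(x, U x) = (a + b)(x\<^sub>1, x\<^sub>1) + (a + b)(x\<^sub>2, x\<^sub>2)\<close>, so the indefinite form \<open>h\<close> is coercive up to
  the automorphism \<open>U\<close> of the form domain, which is a Hilbert space because \<open>a + b\<close> is closed.
  Testing with \<open>U x - \<mu> \<i> x\<close> gives the same for \<open>h - \<mu> \<i>\<close> with real \<open>\<mu>\<close>, and the
  Babuska-Lax-Milgram theorem makes \<open>H - \<mu> \<i>\<close> surjective for \<open>\<mu> = 1, -1\<close>, hence \<open>H\<close> self-adjoint;
  for \<open>\<alpha> + \<beta> > 0\<close> the case \<open>\<mu> = 0\<close> makes \<open>H\<close> itself surjective. Testing instead
  with the multiple \<open>[[\<alpha>, \<beta>], [\<beta>, -\<alpha>]]\<close> of an orthogonal matrix yields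
  \<open>\<parallel>H x\<parallel> \<ge> sqrt (\<alpha>\<^sup>2 + \<beta>\<^sup>2) \<parallel>x\<parallel>\<close>.\<close>

section \<open>Complete real bilinear forms\<close>

text \<open>Discriminant bound, from evaluating at the minimiser \<open>- d / Q\<close>. The slack
  \<open>\<epsilon>\<close> lets it serve both Cauchy-Schwarz and the first variation at
  almost-minimisers.\<close>

lemma square_le_of_quadratic_ge:
  fixes d Q \<epsilon> :: real
  assumes "\<And>t. 2 * t * d + t\<^sup>2 * Q \<ge> - \<epsilon>" "Q \<ge> 0"
  shows "d\<^sup>2 \<le> \<epsilon> * Q"
proof (cases "Q = 0")
  case True
  have "d = 0"
  proof (rule ccontr)
    assume "d \<noteq> 0"
    \<comment> \<open>This \<open>t\<close> makes \<open>2 * t * d\<close> equal to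
      \<open>- (\<epsilon> + 1)\<close>, below the assumed bound.\<close>
    then show False
      using assms(1)[of "- (\<epsilon> + 1) / (2 * d)"] True by simp
  qed
  then show ?thesis using True by simp
next
  case False
  then have "Q > 0" using assms by simp
  have "2 * (- d / Q) * d + (- d / Q)\<^sup>2 * Q = - (d\<^sup>2 / Q)"
    using False by (simp add: power2_eq_square field_simps)
  then have "d\<^sup>2 / Q \<le> \<epsilon>"
    using assms(1)[of "- d / Q"] by linarith
  then show ?thesis using \<open>Q > 0\<close> by (simp add: field_simps)
qed

text \<open>A carrier set is used because form domains are in general proper subspaces. Only
  semidefiniteness is asked for, so that \<open>a\<close> and \<open>b\<close> are instances
  separately.\<close>

locale real_form =
  fixes S :: "'b::real_vector set" and q :: "'b \<Rightarrow> 'b \<Rightarrow> real"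
  assumes subspace: "subspace S"
    and add_left: "\<lbrakk>x \<in> S; y \<in> S; z \<in> S\<rbrakk> \<Longrightarrow> q (x + y) z = q x z + q y z"
    and scale_left: "\<lbrakk>x \<in> S; y \<in> S\<rbrakk> \<Longrightarrow> q (c *\<^sub>R x) y = c * q x y"
    and sym: "\<lbrakk>x \<in> S; y \<in> S\<rbrakk> \<Longrightarrow> q x y = q y x"
    and nonneg: "x \<in> S \<Longrightarrow> q x x \<ge> 0"
begin

lemmas add_mem = subspace_add[OF subspace] and diff_mem = subspace_diff[OF subspace]
  and scale_mem = subspace_scale[OF subspace] and zero_mem = subspace_0[OF subspace]

lemma add_right: "\<lbrakk>x \<in> S; y \<in> S; z \<in> S\<rbrakk> \<Longrightarrow> q z (x + y) = q z x + q z y"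
  using add_left sym add_mem by metis

lemma scale_right: "\<lbrakk>x \<in> S; y \<in> S\<rbrakk> \<Longrightarrow> q x (c *\<^sub>R y) = c * q x y"
  using scale_left sym scale_mem by metis

lemma diff_left: "\<lbrakk>x \<in> S; y \<in> S; z \<in> S\<rbrakk> \<Longrightarrow> q (x - y) z = q x z - q y z"
  using add_left[of x "(-1) *\<^sub>R y" z] scale_left[of y z "-1"] scale_mem[of y "-1"] by simp

lemma diff_right: "\<lbrakk>x \<in> S; y \<in> S; z \<in> S\<rbrakk> \<Longrightarrow> q z (x - y) = q z x - q z y"
  using diff_left sym diff_mem by metis

lemmas bilinear = add_left add_right scale_left scale_right diff_left diff_right
  add_mem diff_mem scale_mem

lemma expand: "\<lbrakk>x \<in> S; y \<in> S\<rbrakk> \<Longrightarrow> q (x + t *\<^sub>R y) (x + t *\<^sub>R y) = q x x + 2 * t * q x y + t\<^sup>2 * q y y"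
  using sym[of y x] by (simp add: bilinear power2_eq_square algebra_simps)

lemma parallelogram:
  "\<lbrakk>x \<in> S; y \<in> S\<rbrakk> \<Longrightarrow> q (x + y) (x + y) + q (x - y) (x - y) = 2 * q x x + 2 * q y y"
  by (simp add: bilinear)

lemma diff_le: "\<lbrakk>x \<in> S; y \<in> S\<rbrakk> \<Longrightarrow> q (x - y) (x - y) \<le> 2 * q x x + 2 * q y y"
  using parallelogram[of x y] nonneg[of "x + y"] add_mem by fastforce

lemma Cauchy_Schwarz:
  assumes "x \<in> S" "y \<in> S"
  shows "(q x y)\<^sup>2 \<le> q x x * q y y"
proof (rule square_le_of_quadratic_ge)
  fix t
  have "0 \<le> q (x + t *\<^sub>R y) (x + t *\<^sub>R y)" using assms nonneg add_mem scale_mem by blast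
  then show "- q x x \<le> 2 * t * q x y + t\<^sup>2 * q y y" using expand[OF assms, of t] by linarith
qed (use assms nonneg in blast)

lemma Cauchy_Schwarz_abs: "\<lbrakk>x \<in> S; y \<in> S\<rbrakk> \<Longrightarrow> \<bar>q x y\<bar> \<le> sqrt (q x x) * sqrt (q y y)"
  using Cauchy_Schwarz[of x y] by (metis real_sqrt_abs real_sqrt_le_mono real_sqrt_mult)

end

text \<open>Completeness refers to \<open>q\<close> alone, so one locale covers the form domain, a
  closed subspace with \<open>inner\<close>, and the form transported by \<open>G\<close> in the
  Lax-Milgram proof.\<close>

locale complete_real_form = real_form +
  assumes definite: "\<lbrakk>x \<in> S; q x x = 0\<rbrakk> \<Longrightarrow> x = 0"
    and complete: "\<lbrakk>\<And>n. u n \<in> S;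
        \<forall>e>0. \<exists>N. \<forall>m\<ge>N. \<forall>n\<ge>N. q (u n - u m) (u n - u m) < e\<rbrakk>
      \<Longrightarrow> \<exists>x\<in>S. (\<lambda>n. q (u n - x) (u n - x)) \<longlonglongrightarrow> 0"
begin

lemma eqI: "\<lbrakk>x \<in> S; y \<in> S; \<And>z. z \<in> S \<Longrightarrow> q x z = q y z\<rbrakk> \<Longrightarrow> x = y"
  using definite[of "x - y"] by (simp add: bilinear)

text \<open>The representing vector minimises \<open>q x x - 2 * f x\<close>; the parallelogram identity makes
  minimising sequences Cauchy.\<close>

lemma riesz:
  assumes f_add: "\<And>x y. \<lbrakk>x \<in> S; y \<in> S\<rbrakk> \<Longrightarrow> f (x + y) = f x + f y"
    and f_scale: "\<And>c x. x \<in> S \<Longrightarrow> f (c *\<^sub>R x) = c * f x"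
    and bounded: "\<And>x. x \<in> S \<Longrightarrow> (f x)\<^sup>2 \<le> C * q x x" and "C \<ge> 0"
  shows "\<exists>u\<in>S. \<forall>x\<in>S. q u x = f x"
proof -
  define E where "E x = q x x - 2 * f x" for x
  have E_lower: "E x \<ge> - C" if "x \<in> S" for x
  proof -
    \<comment> \<open>Arithmetic-geometric mean inequality for \<open>q x x\<close> and
      \<open>C\<close>; taking roots bounds \<open>E\<close> from below.\<close>
    have "(2 * f x)\<^sup>2 \<le> 4 * (C * q x x)" using bounded[OF that] by simp
    also have "\<dots> \<le> (q x x + C)\<^sup>2"
      using zero_le_power2[of "q x x - C"] by (simp add: power2_eq_square algebra_simps)
    finally have "2 * f x \<le> q x x + C"
      by (rule power2_le_imp_le) (use nonneg[OF that] \<open>C \<ge> 0\<close> in simp)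
    then show ?thesis by (simp add: E_def)
  qed
  have bdd: "bdd_below (E ` S)" using E_lower by (auto intro!: bdd_belowI)
  define m where "m = Inf (E ` S)"
  have m_le: "m \<le> E x" if "x \<in> S" for x
    unfolding m_def using bdd that by (intro cInf_lower) auto
  have "\<exists>x\<in>S. E x < m + inverse (real (Suc n))" for n
  proof -
    have "Inf (E ` S) < m + inverse (real (Suc n))" by (simp add: m_def)
    then show ?thesis using cInf_lessD[of "E ` S"] zero_mem by blast
  qed
  then obtain u where u: "\<And>n. u n \<in> S" "\<And>n. E (u n) < m + inverse (real (Suc n))" by metis
  have near: "q (x - y) (x - y) \<le> 2 * (E x - m) + 2 * (E y - m)" if "x \<in> S" "y \<in> S" for x y
  proof -
    \<comment> \<open>At the midpoint \<open>z\<close> of \<open>x\<close> and \<open>y\<close>,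
      \<open>q (x - y) (x - y) = 2 * E x + 2 * E y - 4 * E z\<close>, and
      \<open>E z \<ge> m\<close>.\<close>
    have "m \<le> E ((1/2) *\<^sub>R (x + y))" using that by (intro m_le scale_mem add_mem)
    also have "\<dots> = q (x + y) (x + y) / 4 - (f x + f y)"
      using that by (simp add: E_def f_scale f_add bilinear field_simps)
    finally show ?thesis using parallelogram[OF that] by (simp add: E_def)
  qed
  have "\<exists>N. \<forall>m\<ge>N. \<forall>n\<ge>N. q (u n - u m) (u n - u m) < e" if "e > 0" for e
  proof -
    obtain N where N: "inverse (real (Suc N)) < e / 4" using reals_Archimedean[of "e/4"] \<open>e > 0\<close> by auto
    have "q (u i - u j) (u i - u j) < e" if "i \<ge> N" "j \<ge> N" for i j
    proof -
      have "inverse (real (Suc i)) \<le> inverse (real (Suc N))"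
        "inverse (real (Suc j)) \<le> inverse (real (Suc N))" using that by (auto simp: field_simps)
      then have "E (u i) - m < e / 4" "E (u j) - m < e / 4"
        using u(2)[of i] u(2)[of j] N by linarith+
      then show ?thesis using near[OF u(1)[of i] u(1)[of j]] by argo
    qed
    then show ?thesis by blast
  qed
  then obtain x where x: "x \<in> S" "(\<lambda>n. q (u n - x) (u n - x)) \<longlonglongrightarrow> 0"
    using complete[of u] u(1) by blast
  have "q x y = f y" if "y \<in> S" for y
  proof -
    \<comment> \<open>First variation at the almost-minimiser \<open>u n\<close>: moving along
      \<open>y\<close> lowers \<open>E\<close> by at most \<open>1 / (n + 1)\<close>, so
      \<open>q (u n) y = f y\<close> holds up to an error tending to 0.\<close>
    have bound: "(q (u n) y - f y)\<^sup>2 \<le> inverse (real (Suc n)) * q y y" for n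
    proof (rule square_le_of_quadratic_ge)
      fix t
      have "m \<le> E (u n + t *\<^sub>R y)" using that u(1) by (intro m_le scale_mem add_mem)
      also have "\<dots> = E (u n) + (2 * t * (q (u n) y - f y) + t\<^sup>2 * q y y)"
        using that u(1) by (simp add: E_def expand f_scale f_add scale_mem algebra_simps)
      finally show "- inverse (real (Suc n)) \<le> 2 * t * (q (u n) y - f y) + t\<^sup>2 * q y y"
        using u(2)[of n] by linarith
    qed (rule nonneg[OF that])
    have "(\<lambda>n. (q (u n) y - f y)\<^sup>2) \<longlonglongrightarrow> 0"
    proof (rule tendsto_sandwich[OF _ _ tendsto_const])
      show "(\<lambda>n. inverse (real (Suc n)) * q y y) \<longlonglongrightarrow> 0"
        using tendsto_mult_left_zero[OF LIMSEQ_inverse_real_of_nat] .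
    qed (use bound in auto)
    then have 1: "(\<lambda>n. q (u n) y - f y) \<longlonglongrightarrow> 0"
      by (simp add: power_tendsto_0_iff)
    have "(\<lambda>n. (q (u n - x) y)\<^sup>2) \<longlonglongrightarrow> 0"
    proof (rule tendsto_sandwich[OF _ _ tendsto_const])
      show "(\<lambda>n. q (u n - x) (u n - x) * q y y) \<longlonglongrightarrow> 0"
        using tendsto_mult_left_zero[OF x(2)] .
    qed (use Cauchy_Schwarz u(1) x(1) that diff_mem in auto)
    then have 2: "(\<lambda>n. q (u n - x) y) \<longlonglongrightarrow> 0"
      by (simp add: power_tendsto_0_iff)
    have "(\<lambda>n. (q (u n) y - f y) - q (u n - x) y) \<longlonglongrightarrow> 0"
      using tendsto_diff[OF 1 2] by simp
    then have "(\<lambda>n::nat. q x y - f y) \<longlonglongrightarrow> 0"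
      using u(1) x(1) that by (simp add: bilinear)
    then show ?thesis by (simp add: LIMSEQ_const_iff)
  qed
  then show ?thesis using x(1) by blast
qed

text \<open>The operator \<open>G\<close> representing \<open>B\<close> is bounded below, so \<open>q (G x) (G y)\<close> is again a complete
  form; the Riesz vector of \<open>q r \<circ> G\<close> for that form solves \<open>G u = r\<close>.\<close>

lemma babuska_lax_milgram:
  assumes B_add_left: "\<And>x y z. \<lbrakk>x \<in> S; y \<in> S; z \<in> S\<rbrakk> \<Longrightarrow> B (x + y) z = B x z + B y z"
    and B_scale_left: "\<And>c x y. \<lbrakk>x \<in> S; y \<in> S\<rbrakk> \<Longrightarrow> B (c *\<^sub>R x) y = c * B x y"
    and B_add_right: "\<And>x y z. \<lbrakk>x \<in> S; y \<in> S; z \<in> S\<rbrakk> \<Longrightarrow> B z (x + y) = B z x + B z y"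
    and B_scale_right: "\<And>c x y. \<lbrakk>x \<in> S; y \<in> S\<rbrakk> \<Longrightarrow> B x (c *\<^sub>R y) = c * B x y"
    and B_bounded: "\<And>x y. \<lbrakk>x \<in> S; y \<in> S\<rbrakk> \<Longrightarrow> (B x y)\<^sup>2 \<le> M * q x x * q y y" and "M \<ge> 0"
    and coercive: "\<And>x. x \<in> S \<Longrightarrow> \<exists>y\<in>S. q y y \<le> K * q x x \<and> B x y \<ge> c * q x x" and "c > 0"
    and nondegenerate: "\<And>z. \<lbrakk>z \<in> S; \<And>x. x \<in> S \<Longrightarrow> B x z = 0\<rbrakk> \<Longrightarrow> z = 0"
    and f_add: "\<And>x y. \<lbrakk>x \<in> S; y \<in> S\<rbrakk> \<Longrightarrow> f (x + y) = f x + f y"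
    and f_scale: "\<And>c x. x \<in> S \<Longrightarrow> f (c *\<^sub>R x) = c * f x"
    and f_bounded: "\<And>x. x \<in> S \<Longrightarrow> (f x)\<^sup>2 \<le> C * q x x" and "C \<ge> 0"
  shows "\<exists>u\<in>S. \<forall>x\<in>S. B u x = f x"
proof -
  have "\<exists>g\<in>S. \<forall>y\<in>S. q g y = B x y" if "x \<in> S" for x
    by (rule riesz[where C = "M * q x x"])
      (use that B_add_right B_scale_right B_bounded \<open>M \<ge> 0\<close> nonneg in auto)
  then obtain G where G: "\<And>x. x \<in> S \<Longrightarrow> G x \<in> S" "\<And>x y. \<lbrakk>x \<in> S; y \<in> S\<rbrakk> \<Longrightarrow> q (G x) y = B x y"
    by metis
  have G_add: "G (x + y) = G x + G y" if "x \<in> S" "y \<in> S" for x y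
    using that by (intro eqI) (simp_all add: G B_add_left bilinear)
  have G_scale: "G (t *\<^sub>R x) = t *\<^sub>R G x" if "x \<in> S" for t x
    using that by (intro eqI) (simp_all add: G B_scale_left bilinear)
  \<comment> \<open>Boundedness of \<open>B\<close> is tested at \<open>y = G x\<close>, where
    \<open>B x y = q (G x) (G x)\<close>.\<close>
  have G_upper: "q (G x) (G x) \<le> M * q x x" if "x \<in> S" for x
  proof (cases "q (G x) (G x) = 0")
    case False
    have "(q (G x) (G x))\<^sup>2 \<le> M * q x x * q (G x) (G x)"
      using B_bounded[of x "G x"] G that by simp
    then show ?thesis
      using False nonneg[OF G(1)[OF that]] by (simp add: power2_eq_square)
  qed (use that \<open>M \<ge> 0\<close> nonneg in simp)
  \<comment> \<open>Coercivity and Cauchy-Schwarz for \<open>B x y = q (G x) y\<close>, with one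
    factor \<open>q x x\<close> cancelled; the absolute value covers a \<open>K\<close> of either
    sign.\<close>
  have G_lower: "c\<^sup>2 * q x x \<le> \<bar>K\<bar> * q (G x) (G x)" if "x \<in> S" for x
  proof (cases "q x x = 0")
    case False
    then have pos: "q x x > 0" using nonneg[OF that] by simp
    obtain y where y: "y \<in> S" "q y y \<le> K * q x x" "B x y \<ge> c * q x x"
      using coercive \<open>x \<in> S\<close> by blast
    have "(c * q x x)\<^sup>2 \<le> (B x y)\<^sup>2"
      using y \<open>c > 0\<close> pos by (intro power_mono) auto
    also have "\<dots> \<le> q (G x) (G x) * q y y"
      using Cauchy_Schwarz[of "G x" y] G that y by simp
    also have "\<dots> \<le> q (G x) (G x) * (\<bar>K\<bar> * q x x)"
      using y(2) pos nonneg[OF G(1)[OF that]]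
      by (intro mult_left_mono) (auto intro: order_trans mult_right_mono)
    finally have "(c\<^sup>2 * q x x) * q x x \<le> (\<bar>K\<bar> * q (G x) (G x)) * q x x"
      by (simp add: power2_eq_square algebra_simps)
    then show ?thesis using pos by simp
  qed (use nonneg[OF G(1)[OF that]] in simp)
  \<comment> \<open>A Cauchy sequence for the new form is one for \<open>q\<close> by
    \<open>G_lower\<close>; its \<open>q\<close>-limit is a limit for the new form by
    \<open>G_upper\<close>.\<close>
  interpret G: complete_real_form S "\<lambda>x y. q (G x) (G y)"
  proof unfold_locales
    fix x assume "x \<in> S" "q (G x) (G x) = 0"
    then have "q x x \<le> 0" using G_lower[of x] \<open>c > 0\<close> by (simp add: mult_le_0_iff)
    then show "x = 0" using \<open>x \<in> S\<close> nonneg definite by (metis order_antisym)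
  next
    fix u :: "nat \<Rightarrow> _" assume u: "\<And>n. u n \<in> S"
      "\<forall>e>0. \<exists>N. \<forall>m\<ge>N. \<forall>n\<ge>N. q (G (u n - u m)) (G (u n - u m)) < e"
    have "\<exists>N. \<forall>m\<ge>N. \<forall>n\<ge>N. q (u n - u m) (u n - u m) < e" if "e > 0" for e
    proof -
      \<comment> \<open>The \<open>+ 1\<close> keeps the denominator positive when
        \<open>K = 0\<close>.\<close>
      have "c\<^sup>2 * e / (\<bar>K\<bar> + 1) > 0" using \<open>c > 0\<close> that by (simp add: add_nonneg_pos)
      then obtain N where N: "\<And>m n. \<lbrakk>m \<ge> N; n \<ge> N\<rbrakk> \<Longrightarrow>
          q (G (u n - u m)) (G (u n - u m)) < c\<^sup>2 * e / (\<bar>K\<bar> + 1)" using u(2) by blast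
      have "q (u n - u m) (u n - u m) < e" if "m \<ge> N" "n \<ge> N" for m n
      proof -
        let ?d = "u n - u m"
        have d: "?d \<in> S" using u diff_mem by blast
        have "c\<^sup>2 * q ?d ?d \<le> \<bar>K\<bar> * q (G ?d) (G ?d)" using G_lower d .
        also have "\<dots> \<le> (\<bar>K\<bar> + 1) * q (G ?d) (G ?d)"
          using nonneg[OF G(1)[OF d]] by (simp add: algebra_simps)
        also have "\<dots> < c\<^sup>2 * e" using N[OF that] by (simp add: field_simps add_pos_nonneg)
        finally show ?thesis using \<open>c > 0\<close> by simp
      qed
      then show ?thesis by blast
    qed
    then obtain x where x: "x \<in> S" "(\<lambda>n. q (u n - x) (u n - x)) \<longlonglongrightarrow> 0"
      using complete[of u] u(1) by blast
    have d: "u n - x \<in> S" for n using u(1) x(1) diff_mem by blast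
    have "(\<lambda>n. q (G (u n - x)) (G (u n - x))) \<longlonglongrightarrow> 0"
    proof (rule tendsto_sandwich[OF _ _ tendsto_const])
      show "(\<lambda>n. M * q (u n - x) (u n - x)) \<longlonglongrightarrow> 0"
        using tendsto_mult_right_zero[OF x(2)] .
    qed (use nonneg[OF G(1)[OF d]] G_upper[OF d] in simp_all)
    then show "\<exists>x\<in>S. (\<lambda>n. q (G (u n - x)) (G (u n - x))) \<longlonglongrightarrow> 0" using x(1) by blast
  next
    show "subspace S" by (rule subspace)
  next
    fix x y assume "x \<in> S" "y \<in> S"
    then show "q (G x) (G y) = q (G y) (G x)" using sym G(1) by blast
  qed (simp_all add: G_add G_scale G(1) add_left scale_left nonneg)
  obtain r where r: "r \<in> S" "\<And>x. x \<in> S \<Longrightarrow> q r x = f x"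
    using riesz[OF f_add f_scale f_bounded \<open>C \<ge> 0\<close>] by blast
  have "\<exists>u\<in>S. \<forall>x\<in>S. q (G u) (G x) = q r (G x)"
    by (rule G.riesz[where C = "q r r"])
      (simp_all add: r(1) G(1) G_add G_scale bilinear Cauchy_Schwarz nonneg)
  then obtain u where u: "u \<in> S" "\<And>x. x \<in> S \<Longrightarrow> q (G u) (G x) = q r (G x)" by blast
  have "G u - r \<in> S" using u r G diff_mem by blast
  \<comment> \<open>By the choice of \<open>u\<close>, \<open>G u - r\<close> is
    \<open>q\<close>-orthogonal to the range of \<open>G\<close>, which is exactly the situation
    excluded by nondegeneracy in the second argument.\<close>
  have "G u - r = 0"
  proof (rule nondegenerate)
    fix x assume "x \<in> S"
    then have "B x (G u - r) = q (G x) (G u - r)" using G \<open>G u - r \<in> S\<close> by simp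
    also have "\<dots> = q (G x) (G u) - q (G x) r" using u(1) r(1) G(1) \<open>x \<in> S\<close> by (intro diff_right)
    also have "\<dots> = 0" 
      using u(2)[OF \<open>x \<in> S\<close>] sym[OF G(1) G(1), OF \<open>x \<in> S\<close> u(1)] sym[OF G(1) r(1), OF \<open>x \<in> S\<close>]
      by linarith
    finally show "B x (G u - r) = 0" .
  qed fact
  then show ?thesis using u r G by (metis eq_iff_diff_eq_0)
qed

end

section \<open>Self-adjoint operators\<close>

lemma complex_structureD:
  assumes "complex_structure J"
  shows "linear J" "J (J x) = - x" "inner (J x) (J y) = inner x y"
    "inner x (J y) = - inner (J x) y" "inner x (J x) = 0" "norm (J x) = norm x"
proof -
  show J: "linear J" "J (J x) = - x" "\<And>x y. inner (J x) (J y) = inner x y" for x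
    using assms by (auto simp: complex_structure_def)
  show *: "inner x (J y) = - inner (J x) y" for x y
    using J(3)[of "J x" y] J(2)[of x] by simp
  show "inner x (J x) = 0" using *[of x x] by (simp add: inner_commute)
  show "norm (J x) = norm x" by (simp add: norm_eq_sqrt_inner J(3))
qed

lemma complex_structure_pairJ: "complex_structure J \<Longrightarrow> complex_structure (pairJ J)"
  unfolding complex_structure_def pairJ_def
  by (auto simp: linear_iff inner_prod_def)

lemma cscale_i: "cscale J \<i> x = J x"
  and cscale_real: "cscale J (complex_of_real r) x = r *\<^sub>R x"
  by (simp_all add: cscale_def)

lemma linear_opD:
  assumes "linear_op J T"
  shows "subspace (dom T)" "x \<in> dom T \<Longrightarrow> J x \<in> dom T"
    "\<lbrakk>x \<in> dom T; y \<in> dom T\<rbrakk> \<Longrightarrow> the (T (x + y)) = the (T x) + the (T y)"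
    "x \<in> dom T \<Longrightarrow> the (T (r *\<^sub>R x)) = r *\<^sub>R the (T x)"
    "x \<in> dom T \<Longrightarrow> the (T (J x)) = J (the (T x))"
proof -
  have T: "csubspace J (dom T)"
    "\<forall>x\<in>dom T. \<forall>y\<in>dom T. the (T (x + y)) = the (T x) + the (T y)"
    "\<forall>c. \<forall>x\<in>dom T. the (T (cscale J c x)) = cscale J c (the (T x))"
    using assms unfolding linear_op_def by auto
  show "subspace (dom T)" "x \<in> dom T \<Longrightarrow> J x \<in> dom T" using T(1) by (auto simp: csubspace_def)
  show "\<lbrakk>x \<in> dom T; y \<in> dom T\<rbrakk> \<Longrightarrow> the (T (x + y)) = the (T x) + the (T y)" using T(2) by blast
  show "x \<in> dom T \<Longrightarrow> the (T (r *\<^sub>R x)) = r *\<^sub>R the (T x)"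
    using T(3) cscale_real by metis
  show "x \<in> dom T \<Longrightarrow> the (T (J x)) = J (the (T x))"
    using T(3) cscale_i by metis
qed

text \<open>The imaginary part of the identity at \<open>x\<close> is minus its real part at
  \<open>J x\<close>, and the domain is invariant under \<open>J\<close>.\<close>

lemma cinner_adjoint_iff:
  assumes J: "complex_structure J" and T: "linear_op J T"
  shows "(\<forall>x\<in>dom T. cinner J (the (T x)) y = cinner J x z) \<longleftrightarrow>
    (\<forall>x\<in>dom T. inner (the (T x)) y = inner x z)"
proof (intro iffI ballI)
  fix x assume *: "\<forall>x\<in>dom T. inner (the (T x)) y = inner x z" and x: "x \<in> dom T"
  moreover have "J x \<in> dom T" using x by (rule linear_opD(2)[OF T])
  ultimately have "inner (the (T x)) y = inner x z" "inner (J (the (T x))) y = inner (J x) z"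
    using * linear_opD(5)[OF T] by metis+
  then show "cinner J (the (T x)) y = cinner J x z"
    by (simp add: cinner_def complex_structureD(4)[OF J])
qed (metis cinner_def complex.inject)

lemma eq_zero_if_orthogonal_dense:
  fixes z :: "'a::real_inner"
  assumes "closure D = UNIV" "\<And>x. x \<in> D \<Longrightarrow> inner x z = 0"
  shows "z = 0"
proof -
  have "closed {x. inner x z = 0}" by (intro closed_Collect_eq continuous_intros)
  then have "closure D \<subseteq> {x. inner x z = 0}" using assms(2) by (intro closure_minimal) auto
  then have "inner z z = 0" using assms(1) by blast
  then show ?thesis by simp
qed

text \<open>Density makes \<open>z\<close> unique, which resolves the \<open>THE\<close> in
  \<open>adjoint_op\<close>.\<close>

lemma adjoint_op_eq_Some_iff:
  assumes J: "complex_structure J" and T: "linear_op J T" and dense: "closure (dom T) = UNIV"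
  shows "adjoint_op J T y = Some z \<longleftrightarrow> (\<forall>x\<in>dom T. inner (the (T x)) y = inner x z)"
proof -
  have uniq: "z = z'" if "\<forall>x\<in>dom T. inner (the (T x)) y = inner x z"
    "\<forall>x\<in>dom T. inner (the (T x)) y = inner x z'" for z z'
    using eq_zero_if_orthogonal_dense[OF dense, of "z - z'"] that by (simp add: inner_diff_right)
  define P where "P z \<longleftrightarrow> (\<forall>x\<in>dom T. inner (the (T x)) y = inner x z)" for z
  have "adjoint_op J T y = (if \<exists>z. P z then Some (THE z. P z) else None)"
    unfolding adjoint_op_def cinner_adjoint_iff[OF J T] P_def by simp
  moreover have "(THE z. P z) = z" if "P z" for z
    using that uniq unfolding P_def by (intro the_equality) blast+
  ultimately show ?thesis unfolding P_def[symmetric] by auto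
qed

lemma subspace_closure:
  fixes D :: "'a::real_normed_vector set"
  assumes "subspace D"
  shows "subspace (closure D)"
  unfolding subspace_def
proof (intro conjI ballI allI)
  show "0 \<in> closure D" using subspace_0[OF assms] closure_subset by blast
next
  fix x y assume "x \<in> closure D" "y \<in> closure D"
  then obtain u v where "\<forall>n. u n \<in> D" "u \<longlonglongrightarrow> x" "\<forall>n. v n \<in> D" "v \<longlonglongrightarrow> y"
    by (metis closure_sequential)
  then have "\<forall>n. u n + v n \<in> D" "(\<lambda>n. u n + v n) \<longlonglongrightarrow> x + y"
    using subspace_add[OF assms] tendsto_add by blast+
  then show "x + y \<in> closure D" by (auto simp only: closure_sequential intro!: exI[of _ "\<lambda>n. u n + v n"])
next
  fix c x assume "x \<in> closure D"
  then obtain u where "\<forall>n. u n \<in> D" "u \<longlonglongrightarrow> x" by (metis closure_sequential)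
  then have "\<forall>n. c *\<^sub>R u n \<in> D" "(\<lambda>n. c *\<^sub>R u n) \<longlonglongrightarrow> c *\<^sub>R x"
    using subspace_scale[OF assms] tendsto_scaleR[OF tendsto_const] by blast+
  then show "c *\<^sub>R x \<in> closure D" by (auto simp only: closure_sequential intro!: exI[of _ "\<lambda>n. c *\<^sub>R u n"])
qed

lemma Cauchy_if_inner_Cauchy:
  fixes u :: "nat \<Rightarrow> 'a::real_inner"
  assumes "\<forall>e>0. \<exists>N. \<forall>m\<ge>N. \<forall>n\<ge>N. inner (u n - u m) (u n - u m) < e"
  shows "Cauchy u"
proof (rule metric_CauchyI)
  fix e :: real assume "e > 0"
  then obtain N where N: "\<And>m n. \<lbrakk>m \<ge> N; n \<ge> N\<rbrakk> \<Longrightarrow> inner (u n - u m) (u n - u m) < e\<^sup>2"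
    using assms by (metis zero_less_power)
  have "dist (u m) (u n) < e" if "m \<ge> N" "n \<ge> N" for m n
    unfolding dist_norm
    by (rule power2_less_imp_less) (use N[OF that(2,1)] \<open>e > 0\<close> in \<open>auto simp: power2_norm_eq_inner\<close>)
  then show "\<exists>N. \<forall>m\<ge>N. \<forall>n\<ge>N. dist (u m) (u n) < e" by blast
qed

text \<open>The closed subspace is complete for \<open>inner\<close>, so the Riesz vector
  \<open>u\<close> of \<open>inner v\<close> on it is the orthogonal projection of \<open>v\<close>,
  and \<open>v - u\<close> is orthogonal to \<open>D\<close>.\<close>

lemma closure_eq_UNIV_if_orthogonal:
  fixes D :: "'a::{real_inner,complete_space} set"
  assumes "subspace D" "\<And>z. (\<And>x. x \<in> D \<Longrightarrow> inner x z = 0) \<Longrightarrow> z = 0"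
  shows "closure D = UNIV"
proof -
  interpret complete_real_form "closure D" inner
  proof unfold_locales
    show "subspace (closure D)" using assms(1) by (rule subspace_closure)
    fix u :: "nat \<Rightarrow> 'a" assume u: "\<And>n. u n \<in> closure D"
      "\<forall>e>0. \<exists>N. \<forall>m\<ge>N. \<forall>n\<ge>N. inner (u n - u m) (u n - u m) < e"
    have "Cauchy u"
      using u(2) by (rule Cauchy_if_inner_Cauchy)
    then obtain x where x: "u \<longlonglongrightarrow> x" using Cauchy_convergent convergent_def by blast
    then have "x \<in> closure D" using u(1) closed_sequentially[OF closed_closure] by blast
    moreover have "(\<lambda>n. inner (u n - x) (u n - x)) \<longlonglongrightarrow> inner (x - x) (x - x)"
      by (intro tendsto_intros x)
    ultimately show "\<exists>x\<in>closure D. (\<lambda>n. inner (u n - x) (u n - x)) \<longlonglongrightarrow> 0" by auto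
  qed (auto simp: inner_add_left intro: inner_commute)
  have "v \<in> closure D" for v
  proof -
    have "\<exists>u\<in>closure D. \<forall>x\<in>closure D. inner u x = inner v x"
      by (rule riesz[where C = "inner v v"])
        (auto simp: inner_add_right Cauchy_Schwarz_ineq)
    then obtain u where u: "u \<in> closure D" "\<And>x. x \<in> closure D \<Longrightarrow> inner u x = inner v x" by blast
    have "v - u = 0"
      using u(2) closure_subset[of D] by (intro assms(2)) (metis eq_iff_diff_eq_0 inner_commute inner_diff_right subsetD)
    then show ?thesis using u(1) by simp
  qed
  then show ?thesis by auto
qed

text \<open>If \<open>z\<close> is the adjoint image of \<open>y\<close>, surjectivity of \<open>T + i\<close> gives \<open>y'\<close> in the domain with
  \<open>(T + i) y' = z + i y\<close>, and surjectivity of \<open>T - i\<close> forces \<open>y = y'\<close>.\<close>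

lemma selfadjointI:
  fixes T :: "'a::{real_inner,complete_space} \<Rightarrow> 'a option"
  assumes J: "complex_structure J" and T: "linear_op J T"
    and symmetric: "\<And>x y. \<lbrakk>x \<in> dom T; y \<in> dom T\<rbrakk> \<Longrightarrow> inner (the (T x)) y = inner x (the (T y))"
    and surj_minus: "\<And>w. \<exists>x\<in>dom T. the (T x) - J x = w"
    and surj_plus: "\<And>w. \<exists>x\<in>dom T. the (T x) + J x = w"
  shows "selfadjoint J T"
proof -
  note Jl = linear_diff[OF complex_structureD(1)[OF J]]
  \<comment> \<open>Density also comes from surjectivity: for \<open>z\<close> orthogonal to the
    domain, solve \<open>T x + J x = z\<close> and \<open>T y - J y = x\<close>; symmetry turns
    \<open>inner x x\<close> into \<open>inner y z = 0\<close>.\<close>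
  have dense: "closure (dom T) = UNIV"
  proof (rule closure_eq_UNIV_if_orthogonal)
    fix z assume z: "\<And>x. x \<in> dom T \<Longrightarrow> inner x z = 0"
    obtain x where x: "x \<in> dom T" "the (T x) + J x = z" using surj_plus by blast
    obtain y where y: "y \<in> dom T" "the (T y) - J y = x" using surj_minus by blast
    have "inner x x = inner (the (T y) - J y) x" using y by simp
    also have "\<dots> = inner y (the (T x) + J x)"
      using symmetric[OF y(1) x(1)] complex_structureD(4)[OF J, of y x]
      by (simp add: inner_diff_left inner_add_right)
    also have "\<dots> = 0" using x z[OF y(1)] by simp
    finally have "x = 0" by simp
    then have "the (T x) = 0"
      using linear_opD(4)[OF T x(1), of 0] by simp
    then show "z = 0" using x \<open>x = 0\<close> linear_0[OF complex_structureD(1)[OF J]] by simp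
  qed (rule linear_opD(1)[OF T])
  have "adjoint_op J T y = Some z \<longleftrightarrow> T y = Some z" for y z
  proof
    assume "adjoint_op J T y = Some z"
    then have z: "\<And>x. x \<in> dom T \<Longrightarrow> inner (the (T x)) y = inner x z"
      by (simp add: adjoint_op_eq_Some_iff[OF J T dense])
    obtain y' where y': "y' \<in> dom T" "the (T y') + J y' = z + J y" using surj_plus by blast
    obtain x where x: "x \<in> dom T" "the (T x) - J x = y - y'" using surj_minus by blast
    have "inner (y - y') (y - y') = inner (the (T x) - J x) (y - y')" using x by simp
    also have "\<dots> = inner x (z + J y - (the (T y') + J y'))"
      using z[OF x(1)] symmetric[OF x(1) y'(1)]
        complex_structureD(4)[OF J, of x y] complex_structureD(4)[OF J, of x y']
      by (simp add: inner_diff_left inner_diff_right inner_add_right)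
    also have "\<dots> = 0" using y' by simp
    finally have "y = y'" by simp
    then show "T y = Some z" using y' by auto
  next
    assume "T y = Some z"
    then show "adjoint_op J T y = Some z"
      using symmetric by (force simp: adjoint_op_eq_Some_iff[OF J T dense])
  qed
  then have "adjoint_op J T = T" by (metis ext option.exhaust)
  then show ?thesis using T dense by (simp add: selfadjoint_def)
qed

section \<open>The indefinite block form\<close>

lemma sesq_form_J:
  assumes f: "sesq_form J D f" and "x \<in> D" "y \<in> D"
  shows "f (J x) y = \<i> * f x y" "f x (J y) = - \<i> * f x y"
proof -
  have "f (cscale J \<i> x) y = \<i> * f x y" "f x (cscale J \<i> y) = cnj \<i> * f x y"
    using assms unfolding sesq_form_def by blast+
  then show "f (J x) y = \<i> * f x y" "f x (J y) = - \<i> * f x y"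
    by (simp_all only: cscale_i complex_cnj_i)
qed

text \<open>Real parts give access to the real Riesz theory; imaginary parts are recovered later by
  applying \<open>J\<close> to an argument.\<close>

lemma real_form_Re:
  assumes D: "csubspace J D" and f: "sesq_form J D f" and "symmetric_form D f"
    and "\<And>x. x \<in> D \<Longrightarrow> Re (f x x) \<ge> 0"
  shows "real_form D (\<lambda>x y. Re (f x y))"
proof
  show "subspace D" using D by (simp add: csubspace_def)
  show "Re (f (x + y) z) = Re (f x z) + Re (f y z)" if "x \<in> D" "y \<in> D" "z \<in> D" for x y z
    using f that by (simp add: sesq_form_def)
  show "Re (f (c *\<^sub>R x) y) = c * Re (f x y)" if "x \<in> D" "y \<in> D" for c x y
  proof -
    have "f (cscale J (complex_of_real c) x) y = complex_of_real c * f x y"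
      using f that unfolding sesq_form_def by blast
    then show ?thesis by (simp add: cscale_real)
  qed
  show "Re (f x y) = Re (f y x)" if "x \<in> D" "y \<in> D" for x y
    using assms(3) that unfolding symmetric_form_def by (metis complex_cnj(1) cnj.simps(1))
qed (rule assms(4))

text \<open>Only nonnegativity of the forms is fixed here; the lower bounds \<open>\<alpha>\<close>
  and \<open>\<beta>\<close> enter as hypotheses of the lemmas on the inverse.\<close>

locale form_pair =
  fixes J :: "'a::{real_inner,complete_space} \<Rightarrow> 'a" and D :: "'a set"
    and a b :: "'a \<Rightarrow> 'a \<Rightarrow> complex"
  assumes J: "complex_structure J"
    and D: "csubspace J D" and dense: "closure D = UNIV"
    and a: "sesq_form J D a" and b: "sesq_form J D b"
    and a_sym: "symmetric_form D a" and b_sym: "symmetric_form D b"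
    and a_nonneg: "\<And>z. z \<in> D \<Longrightarrow> Re (a z z) \<ge> 0"
    and b_nonneg: "\<And>z. z \<in> D \<Longrightarrow> Re (b z z) \<ge> 0"
    and closed: "closed_form D (\<lambda>x y. a x y + b x y)"
begin

sublocale A: real_form D "\<lambda>x y. Re (a x y)"
  using real_form_Re[OF D a a_sym a_nonneg] .

sublocale B: real_form D "\<lambda>x y. Re (b x y)"
  using real_form_Re[OF D b b_sym b_nonneg] .

text \<open>The squared form norm of \<open>a + b\<close> on both components, with the Hilbert space
  inner product added to make it definite.\<close>

definition q :: "'a \<times> 'a \<Rightarrow> 'a \<times> 'a \<Rightarrow> real" where
  "q x y = Re (a (fst x) (fst y)) + Re (b (fst x) (fst y))
     + Re (a (snd x) (snd y)) + Re (b (snd x) (snd y)) + inner x y"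

text \<open>The real part of \<open>hform a b\<close>; on the form domain the imaginary part is
  \<open>h x (pairJ J y)\<close>.\<close>

definition h :: "'a \<times> 'a \<Rightarrow> 'a \<times> 'a \<Rightarrow> real" where
  "h x y = Re (a (fst x) (fst y)) + Re (b (snd x) (fst y))
     + Re (b (fst x) (snd y)) - Re (a (snd x) (snd y))"

text \<open>The matrix \<open>[[s, t], [t, -s]]\<close>, which is
  \<open>sqrt (s\<^sup>2 + t\<^sup>2)\<close> times a reflection. The pair \<open>1, 1\<close> gives
  coercivity, the pair \<open>\<alpha>, \<beta>\<close> the sharp norm bound.\<close>

definition rot :: "real \<Rightarrow> real \<Rightarrow> 'a \<times> 'a \<Rightarrow> 'a \<times> 'a" where
  "rot s t x = (s *\<^sub>R fst x + t *\<^sub>R snd x, t *\<^sub>R fst x - s *\<^sub>R snd x)"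

lemma DJ: "x \<in> D \<Longrightarrow> J x \<in> D"
  using D by (simp add: csubspace_def)

lemmas PJ = complex_structureD[OF complex_structure_pairJ[OF J]]

lemma pairJ_mem: "x \<in> D \<times> D \<Longrightarrow> pairJ J x \<in> D \<times> D"
  using DJ by (auto simp: pairJ_def)

lemma subspace_pair: "subspace (D \<times> D)"
  using A.subspace by (simp add: subspace_Times)

lemma dense_pair: "closure (D \<times> D) = UNIV"
  using dense by (simp add: closure_Times)

lemma rot_mem: "x \<in> D \<times> D \<Longrightarrow> rot s t x \<in> D \<times> D"
  by (auto simp: rot_def intro!: A.add_mem A.diff_mem A.scale_mem)

lemma diag_real: "x \<in> D \<Longrightarrow> Im (a x x) = 0" "x \<in> D \<Longrightarrow> Im (b x x) = 0"
  using a_sym b_sym unfolding symmetric_form_def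
  by (metis cnj.simps(2) neg_equal_zero)+

lemma Re_J:
  assumes "x \<in> D" "y \<in> D"
  shows "Re (a (J x) y) = - Im (a x y)" "Re (a x (J y)) = Im (a x y)"
    "Re (b (J x) y) = - Im (b x y)" "Re (b x (J y)) = Im (b x y)"
    "Im (a (J x) y) = Re (a x y)" "Im (a x (J y)) = - Re (a x y)"
    "Im (b (J x) y) = Re (b x y)" "Im (b x (J y)) = - Re (b x y)"
  using sesq_form_J[OF a assms] sesq_form_J[OF b assms] by simp_all

lemma norm_rot: "(norm (rot s t x))\<^sup>2 = (s\<^sup>2 + t\<^sup>2) * (norm x)\<^sup>2"
  unfolding power2_norm_eq_inner
  by (cases x) (simp add: rot_def inner_add_left inner_add_right inner_diff_left inner_diff_right
      inner_commute power2_eq_square algebra_simps)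

section \<open>The form norm and its completeness\<close>

lemma q_ge:
  assumes "x \<in> D \<times> D"
  shows "inner x x \<le> q x x" "Re (a (fst x) (fst x)) \<le> q x x" "Re (a (snd x) (snd x)) \<le> q x x"
    "Re (b (fst x) (fst x)) \<le> q x x" "Re (b (snd x) (snd x)) \<le> q x x"
    "Re (a (fst x) (fst x)) + Re (b (fst x) (fst x)) \<le> q x x"
    "Re (a (snd x) (snd x)) + Re (b (snd x) (snd x)) \<le> q x x"
proof -
  have "fst x \<in> D" "snd x \<in> D" using assms by auto
  then show "inner x x \<le> q x x" "Re (a (fst x) (fst x)) \<le> q x x" "Re (a (snd x) (snd x)) \<le> q x x"
    "Re (b (fst x) (fst x)) \<le> q x x" "Re (b (snd x) (snd x)) \<le> q x x"
    "Re (a (fst x) (fst x)) + Re (b (fst x) (fst x)) \<le> q x x"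
    "Re (a (snd x) (snd x)) + Re (b (snd x) (snd x)) \<le> q x x"
    using a_nonneg[of "fst x"] a_nonneg[of "snd x"] b_nonneg[of "fst x"] b_nonneg[of "snd x"]
      inner_ge_zero[of x]
    unfolding q_def by linarith+
qed

text \<open>On the diagonal \<open>a + b\<close> is real and nonnegative, so the \<open>cmod\<close>
  in \<open>closed_form\<close> is just the real part.\<close>

lemma closed_seq:
  fixes u :: "nat \<Rightarrow> 'a"
  assumes u: "\<And>n. u n \<in> D" "u \<longlonglongrightarrow> x"
    and Cauchy: "\<forall>e>0. \<exists>N. \<forall>m\<ge>N. \<forall>n\<ge>N.
      Re (a (u n - u m) (u n - u m)) + Re (b (u n - u m) (u n - u m)) < e"
  shows "x \<in> D" "(\<lambda>n. Re (a (u n - x) (u n - x)) + Re (b (u n - x) (u n - x))) \<longlonglongrightarrow> 0"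
proof -
  have eq: "cmod (a d d + b d d) = Re (a d d) + Re (b d d)" if "d \<in> D" for d
    using diag_real[OF that] a_nonneg[OF that] b_nonneg[OF that] by (simp add: cmod_eq_Re)
  have "\<forall>e>0. \<exists>N. \<forall>m\<ge>N. \<forall>n\<ge>N. cmod (a (u n - u m) (u n - u m) + b (u n - u m) (u n - u m)) < e"
    using Cauchy eq[OF A.diff_mem[OF u(1) u(1)]] by presburger
  then have *: "x \<in> D \<and> (\<lambda>n. cmod (a (u n - x) (u n - x) + b (u n - x) (u n - x))) \<longlonglongrightarrow> 0"
    using closed u unfolding closed_form_def by blast
  then show "x \<in> D" by blast
  show "(\<lambda>n. Re (a (u n - x) (u n - x)) + Re (b (u n - x) (u n - x))) \<longlonglongrightarrow> 0"
    using * eq[OF A.diff_mem[OF u(1) \<open>x \<in> D\<close>]] by simp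
qed

text \<open>Since \<open>q\<close> dominates \<open>inner\<close>, a \<open>q\<close>-Cauchy
  sequence has a norm limit; closedness of \<open>a + b\<close>, applied to each component, puts it
  in \<open>D \<times> D\<close> and gives form convergence.\<close>

sublocale Q: complete_real_form "D \<times> D" q
proof
  show "subspace (D \<times> D)" by (rule subspace_pair)
  show "q (x + y) z = q x z + q y z" if "x \<in> D \<times> D" "y \<in> D \<times> D" "z \<in> D \<times> D" for x y z
    using that by (auto simp: q_def A.bilinear B.bilinear inner_add_left)
  show "q (c *\<^sub>R x) y = c * q x y" if "x \<in> D \<times> D" "y \<in> D \<times> D" for c x y
    using that by (auto simp: q_def A.bilinear B.bilinear algebra_simps)
  show "q x y = q y x" if "x \<in> D \<times> D" "y \<in> D \<times> D" for x y
    using that A.sym[of "fst x" "fst y"] A.sym[of "snd x" "snd y"]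
      B.sym[of "fst x" "fst y"] B.sym[of "snd x" "snd y"]
    by (auto simp: q_def inner_commute)
  show "0 \<le> q x x" if "x \<in> D \<times> D" for x
    using q_ge(1)[OF that] inner_ge_zero[of x] by linarith
  show "x = 0" if "x \<in> D \<times> D" "q x x = 0" for x
    using q_ge(1)[OF that(1)] that(2) inner_ge_zero[of x] by (metis inner_eq_zero_iff order_antisym)
  fix u :: "nat \<Rightarrow> 'a \<times> 'a" assume u: "\<And>n. u n \<in> D \<times> D"
    and Cauchy: "\<forall>e>0. \<exists>N. \<forall>m\<ge>N. \<forall>n\<ge>N. q (u n - u m) (u n - u m) < e"
  have mem: "u n - u m \<in> D \<times> D" for m n
    using subspace_diff[OF subspace_pair u u] .
  have below: "\<forall>e>0. \<exists>N. \<forall>m\<ge>N. \<forall>n\<ge>N. p (u n - u m) < e"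
    if "\<And>x. x \<in> D \<times> D \<Longrightarrow> p x \<le> q x x" for p
    using Cauchy that[OF mem] by (meson order.strict_trans1)
  have "Cauchy u" using below[of "\<lambda>x. inner x x"] q_ge(1) by (intro Cauchy_if_inner_Cauchy) blast
  then obtain x where x: "u \<longlonglongrightarrow> x" using Cauchy_convergent convergent_def by blast
  have fst: "fst x \<in> D" "(\<lambda>n. Re (a (fst (u n) - fst x) (fst (u n) - fst x))
      + Re (b (fst (u n) - fst x) (fst (u n) - fst x))) \<longlonglongrightarrow> 0"
    using closed_seq[of "\<lambda>n. fst (u n)" "fst x"] u tendsto_fst[OF x]
      below[OF q_ge(6)] by (auto simp: mem_Times_iff)
  have snd: "snd x \<in> D" "(\<lambda>n. Re (a (snd (u n) - snd x) (snd (u n) - snd x))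
      + Re (b (snd (u n) - snd x) (snd (u n) - snd x))) \<longlonglongrightarrow> 0"
    using closed_seq[of "\<lambda>n. snd (u n)" "snd x"] u tendsto_snd[OF x]
      below[OF q_ge(7)] by (auto simp: mem_Times_iff)
  have "(\<lambda>n. inner (u n - x) (u n - x)) \<longlonglongrightarrow> inner (x - x) (x - x)"
    by (intro tendsto_intros x)
  then have "(\<lambda>n. q (u n - x) (u n - x)) \<longlonglongrightarrow> 0"
    using tendsto_add[OF tendsto_add[OF fst(2) snd(2)]]
    by (force simp: q_def algebra_simps)
  then show "\<exists>x\<in>D \<times> D. (\<lambda>n. q (u n - x) (u n - x)) \<longlonglongrightarrow> 0"
    using fst(1) snd(1) by (intro bexI[of _ x]) (auto simp: mem_Times_iff)
qed

section \<open>Identities for the real form \<open>h\<close>\<close>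

lemma h_add_left: "\<lbrakk>x \<in> D \<times> D; y \<in> D \<times> D; z \<in> D \<times> D\<rbrakk> \<Longrightarrow> h (x + y) z = h x z + h y z"
  and h_scale_left: "\<lbrakk>x \<in> D \<times> D; y \<in> D \<times> D\<rbrakk> \<Longrightarrow> h (c *\<^sub>R x) y = c * h x y"
  by (auto simp: h_def A.bilinear B.bilinear algebra_simps)

lemma h_sym: "\<lbrakk>x \<in> D \<times> D; y \<in> D \<times> D\<rbrakk> \<Longrightarrow> h x y = h y x"
  using A.sym[of "fst x" "fst y"] A.sym[of "snd x" "snd y"]
    B.sym[of "fst x" "snd y"] B.sym[of "snd x" "fst y"]
  by (auto simp: h_def)

lemma h_add_right: "\<lbrakk>x \<in> D \<times> D; y \<in> D \<times> D; z \<in> D \<times> D\<rbrakk> \<Longrightarrow> h z (x + y) = h z x + h z y"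
  using h_sym h_add_left subspace_add[OF subspace_pair] by metis

lemma h_scale_right: "\<lbrakk>x \<in> D \<times> D; y \<in> D \<times> D\<rbrakk> \<Longrightarrow> h x (c *\<^sub>R y) = c * h x y"
  using h_sym h_scale_left subspace_scale[OF subspace_pair] by metis

lemma h_pairJ:
  assumes "x \<in> D \<times> D" "y \<in> D \<times> D"
  shows "h (pairJ J x) y = - h x (pairJ J y)"
  using assms Re_J DJ by (auto simp: h_def pairJ_def)

text \<open>The complex form is real at equal arguments, hence purely imaginary once one of them is
  multiplied by \<open>\<i>\<close>.\<close>

lemma h_pairJ_self: "x \<in> D \<times> D \<Longrightarrow> h x (pairJ J x) = 0"
  using h_pairJ[of x x] h_sym[of x "pairJ J x"] pairJ_mem[of x] by simp

text \<open>The mixed terms are \<open>t\<close> times a commutator of \<open>a\<close> and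
  \<open>s\<close> times one of \<open>b\<close>, and vanish by symmetry.\<close>

lemma h_rot:
  assumes "x \<in> D \<times> D"
  shows "h x (rot s t x) = s * (Re (a (fst x) (fst x)) + Re (a (snd x) (snd x)))
    + t * (Re (b (fst x) (fst x)) + Re (b (snd x) (snd x)))"
proof -
  have "fst x \<in> D" "snd x \<in> D" using assms by auto
  then show ?thesis
    using A.sym[of "fst x" "snd x"] B.sym[of "fst x" "snd x"]
    by (simp add: h_def rot_def A.bilinear B.bilinear algebra_simps)
qed

text \<open>The real part of \<open>h x y - \<mu> \<i> (x, y)\<close>.\<close>

definition hs :: "real \<Rightarrow> 'a \<times> 'a \<Rightarrow> 'a \<times> 'a \<Rightarrow> real" where
  "hs \<mu> x y = h x y + \<mu> * inner x (pairJ J y)"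

text \<open>Transposition flips the sign of the shift; nondegeneracy of \<open>hs \<mu>\<close> thus
  reduces to coercivity of \<open>hs (- \<mu>)\<close>.\<close>

lemma hs_sym: "\<lbrakk>x \<in> D \<times> D; y \<in> D \<times> D\<rbrakk> \<Longrightarrow> hs \<mu> x y = hs (- \<mu>) y x"
  using h_sym[of x y] PJ(4)[of x y] by (simp add: hs_def inner_commute)

text \<open>\<open>rot s t\<close> is a real symmetric matrix, so the complex inner product of
  \<open>x\<close> with \<open>rot s t x\<close> is real.\<close>

lemma inner_rot_pairJ: "inner x (pairJ J (rot s t x)) = 0"
proof -
  have "J (c *\<^sub>R y) = c *\<^sub>R J y" "J (y + z) = J y + J z" "J (y - z) = J y - J z" for c y z
    using complex_structureD(1)[OF J] by (simp_all add: linear_scale linear_add linear_diff)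
  then show ?thesis
    using complex_structureD(4)[OF J, of "snd x" "fst x"]
    by (cases x) (simp add: rot_def pairJ_def inner_add_right inner_diff_right inner_commute
        complex_structureD(5)[OF J])
qed

text \<open>The two parts of the test vector decouple: the shift does not see
  \<open>rot 1 1 x\<close> by \<open>inner_rot_pairJ\<close>, and \<open>h\<close> does not see
  \<open>pairJ J x\<close> by \<open>h_pairJ_self\<close>.\<close>

lemma hs_test_vector:
  assumes x: "x \<in> D \<times> D"
  shows "hs \<mu> x (rot 1 1 x - \<mu> *\<^sub>R pairJ J x)
    = h x (rot 1 1 x) + \<mu>\<^sup>2 * inner x x"
proof -
  have "h x (rot 1 1 x - \<mu> *\<^sub>R pairJ J x) = h x (rot 1 1 x)"
    using h_add_right[OF rot_mem[OF x] _ x, of "(- \<mu>) *\<^sub>R pairJ J x"]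
      h_scale_right[OF x pairJ_mem[OF x], of "- \<mu>"] h_pairJ_self[OF x]
      subspace_scale[OF subspace_pair pairJ_mem[OF x], of "- \<mu>"] by simp
  moreover have "pairJ J (rot 1 1 x - \<mu> *\<^sub>R pairJ J x) = pairJ J (rot 1 1 x) + \<mu> *\<^sub>R x"
    using PJ(1) by (simp add: linear_diff linear_scale PJ(2))
  ultimately show ?thesis
    by (simp add: hs_def inner_add_right inner_rot_pairJ power2_eq_square)
qed

section \<open>Bounds and solvability for the shifted form\<close>

lemma q_pairJ: "x \<in> D \<times> D \<Longrightarrow> q (pairJ J x) (pairJ J x) = q x x"
  using Re_J DJ PJ(3)[of x x] by (auto simp: q_def) (auto simp: pairJ_def Re_J DJ)

lemma q_rot:
  assumes "x \<in> D \<times> D"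
  shows "q (rot 1 1 x) (rot 1 1 x) = 2 * q x x"
proof -
  have "fst x \<in> D" "snd x \<in> D" using assms by auto
  moreover have "inner (rot 1 1 x) (rot 1 1 x) = 2 * inner x x"
    using norm_rot[of 1 1 x] by (simp add: power2_norm_eq_inner)
  ultimately show ?thesis
    using A.parallelogram[of "fst x" "snd x"] B.parallelogram[of "fst x" "snd x"]
    by (simp add: q_def) (simp add: rot_def)
qed

text \<open>Each of the four terms of \<open>h\<close>, and the inner product in the shift, is at
  most \<open>P\<close> by Cauchy-Schwarz.\<close>

lemma hs_bounded:
  assumes x: "x \<in> D \<times> D" and y: "y \<in> D \<times> D"
  shows "(hs \<mu> x y)\<^sup>2 \<le> (4 + \<bar>\<mu>\<bar>)\<^sup>2 * q x x * q y y"
proof -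
  define P where "P = sqrt (q x x) * sqrt (q y y)"
  have mem: "fst x \<in> D" "snd x \<in> D" "fst y \<in> D" "snd y \<in> D" using x y by auto
  have "q x x \<ge> 0" "q y y \<ge> 0" using Q.nonneg x y by auto
  have bound: "\<bar>r\<bar> \<le> P" if "\<bar>r\<bar> \<le> sqrt c * sqrt d" "c \<le> q x x" "d \<le> q y y" "d \<ge> 0" for r c d
    unfolding P_def using that mult_mono[of "sqrt c" "sqrt (q x x)" "sqrt d" "sqrt (q y y)"]
      \<open>q x x \<ge> 0\<close> by simp
  have "\<bar>Re (a (fst x) (fst y))\<bar> \<le> P" "\<bar>Re (a (snd x) (snd y))\<bar> \<le> P"
    "\<bar>Re (b (snd x) (fst y))\<bar> \<le> P" "\<bar>Re (b (fst x) (snd y))\<bar> \<le> P"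
    by (rule bound[OF A.Cauchy_Schwarz_abs] bound[OF B.Cauchy_Schwarz_abs];
        use mem q_ge[OF x] q_ge[OF y] a_nonneg b_nonneg in blast)+
  moreover have "\<bar>inner x (pairJ J y)\<bar> \<le> P"
    using bound[of "inner x (pairJ J y)" "inner x x" "inner y y"] q_ge(1)[OF x] q_ge(1)[OF y]
      Cauchy_Schwarz_ineq2[of x "pairJ J y"] by (simp add: PJ(6) norm_eq_sqrt_inner[symmetric])
  then have "\<bar>\<mu> * inner x (pairJ J y)\<bar> \<le> \<bar>\<mu>\<bar> * P" by (simp add: abs_mult mult_left_mono)
  ultimately have "\<bar>hs \<mu> x y\<bar> \<le> (4 + \<bar>\<mu>\<bar>) * P"
    unfolding hs_def h_def by (simp add: distrib_right)
  then have "\<bar>hs \<mu> x y\<bar>\<^sup>2 \<le> ((4 + \<bar>\<mu>\<bar>) * P)\<^sup>2" by (rule power_mono) simp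
  also have "\<dots> = (4 + \<bar>\<mu>\<bar>)\<^sup>2 * q x x * q y y"
    using \<open>q x x \<ge> 0\<close> \<open>q y y \<ge> 0\<close> by (simp add: P_def power_mult_distrib)
  finally show ?thesis by simp
qed

lemma hs_solve:
  assumes lower: "\<And>z. z \<in> D \<Longrightarrow> \<kappa> * (norm z)\<^sup>2 \<le> Re (a z z) + Re (b z z)"
    and "\<kappa> \<ge> 0" and pos: "\<kappa> + \<mu>\<^sup>2 > 0"
  shows "\<exists>x\<in>D \<times> D. \<forall>y\<in>D \<times> D. hs \<mu> x y = inner w y"
proof -
  \<comment> \<open>With \<open>t = h x (rot 1 1 x)\<close> one has
    \<open>q x x = t + inner x x\<close> and \<open>t \<ge> \<kappa> * inner x x\<close>. Half of
    \<open>t\<close> absorbs \<open>c * t\<close>; the other half and the shift absorb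
    \<open>c * inner x x\<close>.\<close>
  define c where "c = min (1/2) ((\<kappa> + \<mu>\<^sup>2) / 2)"
  have "c > 0" using pos by (simp add: c_def)
  have c: "h x (rot 1 1 x) + \<mu>\<^sup>2 * inner x x \<ge> c * q x x" if "x \<in> D \<times> D" for x
  proof -
    define t where "t = h x (rot 1 1 x)"
    have "fst x \<in> D" "snd x \<in> D" using that by auto
    then have "\<kappa> * inner x x \<le> t"
      using lower[of "fst x"] lower[of "snd x"] unfolding t_def h_rot[OF that]
      by (cases x) (simp add: power2_norm_eq_inner distrib_left)
    moreover have q: "q x x = t + inner x x"
      unfolding t_def h_rot[OF that] by (simp add: q_def)
    have "t \<ge> 0" unfolding t_def h_rot[OF that]
      using \<open>fst x \<in> D\<close> \<open>snd x \<in> D\<close> a_nonneg b_nonneg by simp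
    have "c * t \<le> 1/2 * t" using \<open>t \<ge> 0\<close> by (intro mult_right_mono) (auto simp: c_def)
    moreover have "c * inner x x \<le> (\<kappa> * inner x x + \<mu>\<^sup>2 * inner x x) / 2"
      using mult_right_mono[OF min.cobounded2[of "1/2" "(\<kappa> + \<mu>\<^sup>2) / 2"] inner_ge_zero[of x]]
      by (simp add: c_def distrib_right)
    moreover have "\<mu>\<^sup>2 * inner x x \<ge> 0" by simp
    ultimately have "c * t + c * inner x x \<le> t + \<mu>\<^sup>2 * inner x x" by argo
    then show ?thesis unfolding q t_def[symmetric] by (simp only: distrib_left)
  qed
  show ?thesis
  proof (rule Q.babuska_lax_milgram[where M = "(4 + \<bar>\<mu>\<bar>)\<^sup>2" and C = "inner w w"
        and K = "4 + 2 * \<mu>\<^sup>2" and c = c])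
    fix x y z assume "x \<in> D \<times> D" "y \<in> D \<times> D" "z \<in> D \<times> D"
    then show "hs \<mu> (x + y) z = hs \<mu> x z + hs \<mu> y z" "hs \<mu> z (x + y) = hs \<mu> z x + hs \<mu> z y"
      using PJ(1) by (simp_all add: hs_def h_add_left h_add_right linear_add inner_add_left
          inner_add_right algebra_simps)
  next
    fix r x y assume "x \<in> D \<times> D" "y \<in> D \<times> D"
    then show "hs \<mu> (r *\<^sub>R x) y = r * hs \<mu> x y" "hs \<mu> x (r *\<^sub>R y) = r * hs \<mu> x y"
      using PJ(1) by (simp_all add: hs_def h_scale_left h_scale_right linear_scale algebra_simps)
  next
    fix x assume x: "x \<in> D \<times> D"
    let ?y = "rot 1 1 x - \<mu> *\<^sub>R pairJ J x"
    have J: "\<mu> *\<^sub>R pairJ J x \<in> D \<times> D" by (intro Q.scale_mem pairJ_mem x)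
    have "?y \<in> D \<times> D" by (intro Q.diff_mem rot_mem J x)
    \<comment> \<open>\<open>Q.diff_le\<close> doubles both contributions: \<open>2 * q x x\<close>
      from \<open>rot 1 1 x\<close> and \<open>\<mu>\<^sup>2 * q x x\<close> from the shift.\<close>
    moreover have "q ?y ?y \<le> (4 + 2 * \<mu>\<^sup>2) * q x x"
      using Q.diff_le[OF rot_mem[OF x, of 1 1] J] pairJ_mem[OF x] J
      by (simp add: q_rot[OF x] Q.scale_left Q.scale_right q_pairJ[OF x] power2_eq_square algebra_simps)
    ultimately show "\<exists>y\<in>D \<times> D. q y y \<le> (4 + 2 * \<mu>\<^sup>2) * q x x \<and> c * q x x \<le> hs \<mu> x y"
      using c[OF x] hs_test_vector[OF x] by metis
  next
    fix z assume z: "z \<in> D \<times> D" "\<And>x. x \<in> D \<times> D \<Longrightarrow> hs \<mu> x z = 0"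
    \<comment> \<open>This is the test vector of \<open>z\<close> for the shift
      \<open>- \<mu>\<close>, left unsimplified to match \<open>hs_test_vector\<close>.\<close>
    let ?x = "rot 1 1 z - (- \<mu>) *\<^sub>R pairJ J z"
    have x: "?x \<in> D \<times> D" using z(1) by (intro Q.diff_mem rot_mem Q.scale_mem pairJ_mem)
    then have "hs (- \<mu>) z ?x = 0" using hs_sym[OF x z(1), of \<mu>] z(2)[OF x] by metis
    then have "c * q z z \<le> 0" using c[OF z(1)] unfolding hs_test_vector[OF z(1)] by simp
    then have "q z z \<le> 0" using \<open>c > 0\<close> by (simp add: mult_le_0_iff)
    then show "z = 0" using Q.definite Q.nonneg z(1) by (metis order_antisym)
  next
    fix x assume x: "x \<in> D \<times> D"
    have "(inner w x)\<^sup>2 \<le> inner w w * inner x x" by (rule Cauchy_Schwarz_ineq)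
    also have "\<dots> \<le> inner w w * q x x" by (intro mult_left_mono q_ge(1) x) simp
    finally show "(inner w x)\<^sup>2 \<le> inner w w * q x x" .
  qed (use \<open>c > 0\<close> in \<open>simp_all add: hs_bounded inner_add_right\<close>)
qed

section \<open>The operator of the form, its self-adjointness and its inverse\<close>

definition H0 :: "'a \<times> 'a \<Rightarrow> ('a \<times> 'a) option" where
  "H0 x = (if x \<in> D \<times> D \<and> (\<exists>w. \<forall>y\<in>D \<times> D. h x y = inner w y)
    then Some (THE w. \<forall>y\<in>D \<times> D. h x y = inner w y) else None)"

text \<open>Density of \<open>D \<times> D\<close> makes the representing vector unique, so
  \<open>H0\<close> is the largest operator representing \<open>h\<close>.\<close>

lemma H0_eq_Some_iff: "H0 x = Some w \<longleftrightarrow> x \<in> D \<times> D \<and> (\<forall>y\<in>D \<times> D. h x y = inner w y)"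
proof -
  define P where "P w \<longleftrightarrow> (\<forall>y\<in>D \<times> D. h x y = inner w y)" for w
  have uniq: "v = w" if "P v" "P w" for v w
  proof -
    have "v - w = 0"
    proof (rule eq_zero_if_orthogonal_dense[OF dense_pair])
      fix y assume "y \<in> D \<times> D"
      then have "inner v y = inner w y" using that unfolding P_def by metis
      then show "inner y (v - w) = 0" by (simp add: inner_diff_right inner_commute)
    qed
    then show ?thesis by simp
  qed
  then have the: "(THE w. P w) = w" if "P w" for w using that by blast
  have "(if x \<in> D \<times> D \<and> (\<exists>w. P w) then Some (THE w. P w) else None) = Some w \<longleftrightarrow> x \<in> D \<times> D \<and> P w"
    using the by (metis option.distinct(1) option.inject)
  then show ?thesis unfolding H0_def P_def .
qed

lemma H0_SomeD:
  assumes "H0 x = Some w"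
  shows "x \<in> D \<times> D" "y \<in> D \<times> D \<Longrightarrow> h x y = inner w y"
  using assms unfolding H0_eq_Some_iff by blast+

lemma the_H0:
  assumes "x \<in> dom H0"
  shows "x \<in> D \<times> D" "y \<in> D \<times> D \<Longrightarrow> inner (the (H0 x)) y = h x y"
proof -
  have "H0 x = Some (the (H0 x))" using assms by auto
  from H0_SomeD[OF this] show "x \<in> D \<times> D" "y \<in> D \<times> D \<Longrightarrow> inner (the (H0 x)) y = h x y"
    by simp_all
qed

text \<open>The imaginary part of the complex identity at \<open>y\<close> is the real identity at
  \<open>pairJ J y\<close>, and \<open>D \<times> D\<close> is invariant under
  \<open>pairJ J\<close>.\<close>

lemma hform_eq_cinner_iff:
  assumes x: "x \<in> D \<times> D"
  shows "(\<forall>y\<in>D \<times> D. hform a b x y = cinner (pairJ J) w y) \<longleftrightarrow> (\<forall>y\<in>D \<times> D. h x y = inner w y)"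
    (is "?L \<longleftrightarrow> ?R")
proof
  assume ?L
  then show ?R by (force simp: cinner_def hform_def h_def complex_eq_iff)
next
  assume R: ?R
  have "hform a b x y = cinner (pairJ J) w y" if y: "y \<in> D \<times> D" for y
  proof -
    have "Im (hform a b x y) = h x (pairJ J y)"
      using x y Re_J by (auto simp: hform_def h_def pairJ_def)
    moreover have "Re (hform a b x y) = h x y" by (simp add: hform_def h_def)
    ultimately show ?thesis using R y pairJ_mem[OF y] by (simp add: cinner_def complex_eq_iff)
  qed
  then show ?L by blast
qed

lemma H0_add: "\<lbrakk>H0 x = Some v; H0 y = Some w\<rbrakk> \<Longrightarrow> H0 (x + y) = Some (v + w)"
  unfolding H0_eq_Some_iff using Q.add_mem by (simp add: h_add_left inner_add_left)

lemma H0_scale: "H0 x = Some v \<Longrightarrow> H0 (c *\<^sub>R x) = Some (c *\<^sub>R v)"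
  unfolding H0_eq_Some_iff using Q.scale_mem by (simp add: h_scale_left)

lemma H0_pairJ: "H0 x = Some v \<Longrightarrow> H0 (pairJ J x) = Some (pairJ J v)"
  unfolding H0_eq_Some_iff using pairJ_mem PJ(4)[of v] h_pairJ by (metis minus_equation_iff)

lemma linear_op_H0: "linear_op (pairJ J) H0"
proof -
  have "H0 0 = Some 0"
    unfolding H0_eq_Some_iff using Q.zero_mem h_scale_left[of 0 _ 0] by simp
  then have "subspace (dom H0)"
    unfolding subspace_def using H0_add H0_scale by blast
  moreover have "H0 (cscale (pairJ J) c x) = Some (cscale (pairJ J) c v)" if "H0 x = Some v" for c x v
    unfolding cscale_def by (intro H0_add H0_scale H0_pairJ that)
  ultimately show ?thesis
    unfolding linear_op_def csubspace_def using H0_add H0_pairJ by fastforce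
qed

text \<open>Surjectivity of \<open>H0 - \<mu> \<i>\<close>. The sign of the shift changes when
  \<open>pairJ J\<close> moves to the first argument of \<open>inner\<close>.\<close>

lemma H0_minus_surj:
  assumes "\<And>z. z \<in> D \<Longrightarrow> \<kappa> * (norm z)\<^sup>2 \<le> Re (a z z) + Re (b z z)" "\<kappa> \<ge> 0" "\<kappa> + \<mu>\<^sup>2 > 0"
  shows "\<exists>x. H0 x = Some (w + \<mu> *\<^sub>R pairJ J x)"
proof -
  obtain x where "x \<in> D \<times> D" "\<forall>y\<in>D \<times> D. hs \<mu> x y = inner w y"
    using hs_solve[OF assms] by blast
  then have "H0 x = Some (w + \<mu> *\<^sub>R pairJ J x)"
    unfolding H0_eq_Some_iff hs_def by (simp add: inner_add_left PJ(4) diff_eq_eq)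
  then show ?thesis by blast
qed

lemma selfadjoint_H0: "selfadjoint (pairJ J) H0"
proof (rule selfadjointI[OF complex_structure_pairJ[OF J] linear_op_H0])
  show "inner (the (H0 x)) y = inner x (the (H0 y))" if "x \<in> dom H0" "y \<in> dom H0" for x y
    using the_H0[OF that(1)] the_H0[OF that(2)] h_sym by (simp add: inner_commute)
  \<comment> \<open>With \<open>\<kappa> = 0\<close> the shift alone supplies coercivity.\<close>
  have *: "\<exists>x. H0 x = Some (w + \<mu> *\<^sub>R pairJ J x)" if "\<mu>\<^sup>2 = 1" for w \<mu>
    by (rule H0_minus_surj[of 0]) (use that a_nonneg b_nonneg in auto)
  show "\<exists>x\<in>dom H0. the (H0 x) - pairJ J x = w" for w
    using *[of 1 w] by force
  show "\<exists>x\<in>dom H0. the (H0 x) + pairJ J x = w" for w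
    using *[of "-1" w] by force
qed

text \<open>A self-adjoint \<open>H\<close> representing the form satisfies \<open>H \<subseteq> H0 \<subseteq> H* = H\<close>.\<close>

lemma represents_iff:
  "selfadjoint (pairJ J) H \<and> dom H \<subseteq> D \<times> D \<and>
    (\<forall>x\<in>dom H. \<forall>y\<in>D \<times> D. hform a b x y = cinner (pairJ J) (the (H x)) y) \<longleftrightarrow> H = H0"
proof
  assume H: "selfadjoint (pairJ J) H \<and> dom H \<subseteq> D \<times> D \<and>
    (\<forall>x\<in>dom H. \<forall>y\<in>D \<times> D. hform a b x y = cinner (pairJ J) (the (H x)) y)"
  then have linear: "linear_op (pairJ J) H" and dense: "closure (dom H) = UNIV"
    and adjoint: "adjoint_op (pairJ J) H = H" by (auto simp: selfadjoint_def)
  have sub: "H0 x = Some (the (H x))" if "x \<in> dom H" for x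
  proof -
    have x: "x \<in> D \<times> D" using H that by blast
    moreover have "\<forall>y\<in>D \<times> D. hform a b x y = cinner (pairJ J) (the (H x)) y" using H that by blast
    ultimately show ?thesis by (simp only: H0_eq_Some_iff hform_eq_cinner_iff)
  qed
  have "H x = Some w" if "H0 x = Some w" for x w
  proof -
    note w = that
    have "inner (the (H y)) x = inner y w" if y: "y \<in> dom H" for y
    proof -
      have "inner (the (H y)) x = h y x"
        using H0_SomeD(2)[OF sub[OF y]] H0_SomeD(1)[OF w] by simp
      also have "\<dots> = inner y w"
        using H0_SomeD(1)[OF sub[OF y]] H0_SomeD[OF w] h_sym[of y x] by (simp add: inner_commute)
      finally show ?thesis .
    qed
    then show ?thesis
      using adjoint_op_eq_Some_iff[OF complex_structure_pairJ[OF J] linear dense] adjoint by metis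
  qed
  then have "H x = Some w \<longleftrightarrow> H0 x = Some w" for x w using sub[of x] by fastforce
  then show "H = H0" by (metis ext option.exhaust)
next
  have "\<forall>y\<in>D \<times> D. hform a b x y = cinner (pairJ J) (the (H0 x)) y" if "x \<in> dom H0" for x
    unfolding hform_eq_cinner_iff[OF the_H0(1)[OF that]] using the_H0(2)[OF that] by simp
  moreover assume "H = H0"
  ultimately show "selfadjoint (pairJ J) H \<and> dom H \<subseteq> D \<times> D \<and>
    (\<forall>x\<in>dom H. \<forall>y\<in>D \<times> D. hform a b x y = cinner (pairJ J) (the (H x)) y)"
    using selfadjoint_H0 the_H0(1) by blast
qed

text \<open>Among the vectors \<open>rot s t x\<close>, the choice \<open>\<alpha>, \<beta>\<close>
  maximises the guaranteed lower bound
  \<open>(s * \<alpha> + t * \<beta>) * (norm x)\<^sup>2\<close> of the form relative to the norm of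
  the test vector.\<close>

lemma H0_lower_bound:
  assumes \<alpha>: "\<alpha> \<ge> 0" "\<And>z. z \<in> D \<Longrightarrow> \<alpha> * (norm z)\<^sup>2 \<le> Re (a z z)"
    and \<beta>: "\<beta> \<ge> 0" "\<And>z. z \<in> D \<Longrightarrow> \<beta> * (norm z)\<^sup>2 \<le> Re (b z z)"
    and w: "H0 x = Some w"
  shows "sqrt (\<alpha>\<^sup>2 + \<beta>\<^sup>2) * norm x \<le> norm w"
proof -
  define r where "r = sqrt (\<alpha>\<^sup>2 + \<beta>\<^sup>2)"
  have r: "r \<ge> 0" "r\<^sup>2 = \<alpha>\<^sup>2 + \<beta>\<^sup>2" by (simp_all add: r_def)
  have x: "x \<in> D \<times> D" "fst x \<in> D" "snd x \<in> D" using H0_SomeD(1)[OF w] by auto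
  have split: "(norm x)\<^sup>2 = (norm (fst x))\<^sup>2 + (norm (snd x))\<^sup>2"
    by (cases x) (simp add: power2_norm_eq_inner)
  have "(norm (rot \<alpha> \<beta> x))\<^sup>2 = (r * norm x)\<^sup>2"
    unfolding norm_rot power_mult_distrib r(2) ..
  then have norm_y: "norm (rot \<alpha> \<beta> x) = r * norm x"
    using r(1) by (intro power2_eq_imp_eq[of _ "r * norm x"]) simp_all
  have "r\<^sup>2 * (norm x)\<^sup>2 = \<alpha> * (\<alpha> * (norm (fst x))\<^sup>2 + \<alpha> * (norm (snd x))\<^sup>2)
      + \<beta> * (\<beta> * (norm (fst x))\<^sup>2 + \<beta> * (norm (snd x))\<^sup>2)"
    unfolding r split by (simp add: power2_eq_square algebra_simps)
  also have "\<dots> \<le> h x (rot \<alpha> \<beta> x)"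
    unfolding h_rot[OF x(1)] using \<alpha> \<beta> x by (intro add_mono mult_left_mono) auto
  also have "\<dots> = inner w (rot \<alpha> \<beta> x)" by (rule H0_SomeD(2)[OF w rot_mem[OF x(1)]])
  also have "\<dots> \<le> norm w * (r * norm x)" unfolding norm_y[symmetric] by (rule norm_cauchy_schwarz)
  finally have "(r * norm x) * (r * norm x) \<le> norm w * (r * norm x)"
    by (simp add: power2_eq_square algebra_simps)
  \<comment> \<open>The common factor \<open>r * norm x\<close> is cancelled; if it is 0 the claim
    is trivial.\<close>
  then have "r * norm x \<le> norm w"
    using r(1) by (meson mult_right_le_imp_le norm_ge_zero mult_nonneg_nonneg not_le order_trans)
  then show ?thesis by (simp add: r_def)
qed

lemma bounded_inverse_H0:
  assumes \<alpha>: "\<alpha> \<ge> 0" "\<And>z. z \<in> D \<Longrightarrow> \<alpha> * (norm z)\<^sup>2 \<le> Re (a z z)"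
    and \<beta>: "\<beta> \<ge> 0" "\<And>z. z \<in> D \<Longrightarrow> \<beta> * (norm z)\<^sup>2 \<le> Re (b z z)"
    and pos: "\<alpha> \<noteq> 0 \<or> \<beta> \<noteq> 0"
  shows "bounded_inverse_le H0 (1 / sqrt (\<alpha>\<^sup>2 + \<beta>\<^sup>2))"
proof -
  define r where "r = sqrt (\<alpha>\<^sup>2 + \<beta>\<^sup>2)"
  have "r > 0" using pos by (simp add: r_def sum_power2_gt_zero_iff)
  have lower: "r * norm x \<le> norm w" if "H0 x = Some w" for x w
    unfolding r_def using H0_lower_bound[OF \<alpha> \<beta> that] .
  have "\<exists>x. H0 x = Some w" for w
  proof -
    have "\<alpha> + \<beta> > 0" using \<alpha>(1) \<beta>(1) pos by linarith
    then show ?thesis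
      \<comment> \<open>No shift is used here: \<open>\<kappa> = \<alpha> + \<beta>\<close> is
        positive by itself.\<close>
      using H0_minus_surj[of "\<alpha> + \<beta>" 0 w] \<alpha>(2) \<beta>(2) by (simp add: distrib_right add_mono)
  qed
  then obtain G where G: "\<And>w. H0 (G w) = Some w" by metis
  \<comment> \<open>The lower bound applied to the difference, which \<open>H0\<close> sends to 0.
    Linearity of \<open>G\<close> follows, since both sides of each identity have the same image
    under \<open>H0\<close>.\<close>
  have inj: "x = y" if "H0 x = Some w" "H0 y = Some w" for x y w
  proof -
    have "H0 (x + (-1) *\<^sub>R y) = Some (w + (-1) *\<^sub>R w)" by (intro H0_add H0_scale that)
    then have "r * norm (x - y) \<le> 0" using lower by fastforce
    then show ?thesis using \<open>r > 0\<close> by (simp add: mult_le_0_iff)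
  qed
  have bound: "norm (G w) \<le> 1 / r * norm w" for w
    using lower[OF G, of w] \<open>r > 0\<close> by (simp add: field_simps)
  have "bounded_linear G"
  proof (rule bounded_linear_intro)
    show "G (v + w) = G v + G w" for v w by (rule inj[OF G H0_add[OF G G]])
    show "G (c *\<^sub>R w) = c *\<^sub>R G w" for c w by (rule inj[OF G H0_scale[OF G]])
    show "norm (G w) \<le> norm w * (1 / r)" for w using bound[of w] by (simp add: mult.commute)
  qed
  moreover have "\<forall>x\<in>dom H0. G (the (H0 x)) = x" using inj[OF G] by auto
  ultimately show ?thesis
    unfolding bounded_inverse_le_def r_def[symmetric] using G bound by blast
qed

end

theorem theorem4p1:
  fixes J :: "'a::{real_inner,complete_space} \<Rightarrow> 'a"
    and D :: "'a set" and a b :: "'a \<Rightarrow> 'a \<Rightarrow> complex" and \<alpha> \<beta> :: real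
  assumes "complex_structure J"
    and "csubspace J D" and "closure D = UNIV"
    and "sesq_form J D a" and "sesq_form J D b"
    and "symmetric_form D a" and "symmetric_form D b"
    and "\<alpha> \<ge> 0" and "\<beta> \<ge> 0"
    and "\<forall>z\<in>D. Re (a z z) \<ge> \<alpha> * (norm z)\<^sup>2"
    and "\<forall>z\<in>D. Re (b z z) \<ge> \<beta> * (norm z)\<^sup>2"
    and "closed_form D (\<lambda>x y. a x y + b x y)"
  shows "(\<exists>!H. selfadjoint (pairJ J) H \<and> dom H \<subseteq> D \<times> D \<and>
            (\<forall>x\<in>dom H. \<forall>y\<in>D \<times> D. hform a b x y = cinner (pairJ J) (the (H x)) y))
       \<and> (\<forall>H. selfadjoint (pairJ J) H \<and> dom H \<subseteq> D \<times> D \<and>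
            (\<forall>x\<in>dom H. \<forall>y\<in>D \<times> D. hform a b x y = cinner (pairJ J) (the (H x)) y) \<longrightarrow>
            (\<alpha> \<noteq> 0 \<or> \<beta> \<noteq> 0) \<longrightarrow> bounded_inverse_le H (1 / sqrt (\<alpha>\<^sup>2 + \<beta>\<^sup>2)))"
proof -
  have nonneg: "Re (a z z) \<ge> 0" "Re (b z z) \<ge> 0" if "z \<in> D" for z
    using assms(8-11) that by (meson mult_nonneg_nonneg order_trans zero_le_power2)+
  interpret form_pair J D a b
    by unfold_locales (use assms nonneg in blast)+
  \<comment> \<open>Unfolding \<open>represents_iff\<close> turns the characterising property into
    \<open>H = H0\<close> in both conjuncts, leaving only the bound for \<open>H0\<close>.\<close>
  show ?thesis
    unfolding represents_iff using bounded_inverse_H0[of \<alpha> \<beta>] assms(8-11) by blast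
qed

end
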